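(* Let $N_g\ge 1$, let $\bm m_1,\dots,\bm m_{N_g}\in\mathbb R^3$ satisfy $0<m_-\le\|\bm m_i\|_2\le m_+$ for all $i$, let $H\in\mathbb R^{3N_g\times 3N_g}$ with $H=H^T\succ0$, let $\lambda>0$, and let $S$, $B$, $\mathcal A$, $\mathcal H$, $\mathcal S$, $\mathcal M_\lambda$ be as defined in the context. Define $$\mathcal T_\lambda=(\lambda\mathcal I+\mathcal S)^{-1}(\lambda\mathcal I-\mathcal H)(\lambda\mathcal I+\mathcal H)^{-1}(\lambda\mathcal I-\mathcal S),$$ $$q_H(\lambda)=\max_{\mu\in\sigma(H)}\left|\frac{\lambda-\mu}{\lambda+\mu}\right|,\qquad \gamma_m(\lambda)=\min_i\frac{2\lambda\|\bm m_i\|_2}{\lambda^2+\|\bm m_i\|_2^2},$$ $$\vartheta_2(\lambda)=\left[1-\frac{(1-q_H(\lambda)^2)\gamma_m(\lambda)^2}{\gamma_m(\lambda)^2+1+q_H(\lambda)^2}\right]^{1/2}.$$ Then $q_H(\lambda)<1$, $\vartheta_2(\lambda)<1$, and, in the norm $\|\bm x\|_{\lambda,\mathcal S}:=\|(\lambda\mathcal I+\mathcal S)\bm x\|_2$, for every $\bm x\in\mathbb R^{4N_g}$ and every integer $j\ge0$, $$\|\mathcal T_\lambda^{\,2j}\bm x\|_{\lambda,\mathcal S}\le\vartheta_2(\lambda)^j\,\|\bm x\|_{\lambda,\mathcal S}.$$ Consequently the stationary HSS iteration for $\mathcal A\bm x=\bm b$ (defined in the context) converges. Moreover, consider unrestarted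 left-preconditioned GMRES for $\mathcal A\bm x=\bm b$, i.e. GMRES applied to $\mathcal P_\lambda=\mathcal M_\lambda^{-1}\mathcal A$, with iterates $\bm x_j$ and preconditioned residuals $\mathfrak r_j=\mathcal M_\lambda^{-1}(\bm b-\mathcal A\bm x_j)$, $\mathfrak r_0\neq0$. At every even iteration, $$\frac{\|\mathfrak r_{2j}\|_2}{\|\mathfrak r_0\|_2}\le\kappa_\lambda\,\vartheta_2(\lambda)^j,\qquad \kappa_\lambda=\left(\frac{\lambda^2+m_+^2}{\lambda^2+m_-^2}\right)^{1/2}.$$ If $\|\bm m_i\|_2=1$ for all $i$ (with $m_-=m_+=1$), then $\kappa_\lambda=1$ and $\gamma_m=2\lambda/(\lambda^2+1)$.
   Context: Vectors in $\mathbb R^{4N_g}$ are written $(\bm v,\bm r)$ with velocity part $\bm v\in\mathbb R^{3N_g}$ (three components per node $i$) and multiplier part $\bm r\in\mathbb R^{N_g}$. Given $\bm m_1,\dots,\bm m_{N_g}\in\mathbb R^3$: - $S\in\mathbb R^{3N_g\times3N_g}$ is block diagonal with $3\times3$ blocks $\Lambda_i$, where $\Lambda_i\bm a=\bm m_i\times\bm a$ (so $S^T=-S$). - $B\in\mathbb R^{N_g\times3N_g}$ is block diagonal with $1\times3$ blocks $B_i=\bm m_i^T$. - $\mathcal A=\begin{bmatrix}H+S&B^T\\-B&0\end{bmatrix}=\mathcal H+\mathcal S$, with $\mathcal H=\begin{bmatrix}H&0\\0&0\end{bmatrix}$ and $\mathcal S=\begin{bmatrix}S&B^T\\-B&0\end{bmatrix}$;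 $\mathcal I$ is the $4N_g\times4N_g$ identity. - $\mathcal M_\lambda=(\lambda\mathcal I+\mathcal H)(\lambda\mathcal I+\mathcal S)$. $\sigma(\cdot)$ denotes the spectrum. The stationary HSS iteration, for a given right-hand side $\bm b$ and arbitrary $\bm x^{(0)}$, is $(\mathcal H+\lambda\mathcal I)\bm x^{(k+1/2)}=(\lambda\mathcal I-\mathcal S)\bm x^{(k)}+\bm b$, $(\mathcal S+\lambda\mathcal I)\bm x^{(k+1)}=(\lambda\mathcal I-\mathcal H)\bm x^{(k+1/2)}+\bm b$; its error satisfies $\bm e^{(k+1)}=\mathcal T_\lambda\bm e^{(k)}$. Convergence means convergence to the solution of $\mathcal A\bm x=\bm b$ for every $\bm x^{(0)}$. Unrestarted left-preconditioned GMRES (exact arithmetic): $\bm x_j\in\bm x_0+\mathrm{span}\{\mathfrak r_0,\mathcal P_\lambda\mathfrak r_0,\dots,\mathcal P_\lambda^{j-1}\mathfrak r_0\}$ minimizes $\|\mathcal M_\lambda^{-1}(\bm b-\mathcal A\bm x)\|_2$ over this affine space. *)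

theory Defs
  imports "HOL-Analysis.Analysis"
begin

text \<open>
  The \<open>N\<^sub>g\<close> nodes are the elements of a finite type \<^typ>\<open>'n\<close>.  Velocity unknowns are indexed by
  \<^typ>\<open>'n \<times> 3\<close>, multipliers by \<^typ>\<open>'n\<close>, and full vectors by \<^typ>\<open>'n \<times> 3 + 'n\<close>.  As usual,
  \<^typ>\<open>real^'c^'r\<close> has rows indexed by \<^typ>\<open>'r\<close> and columns by \<^typ>\<open>'c\<close>, and
  \<^term>\<open>mat c\<close> is the scalar multiple \<open>c I\<close> of the identity.
\<close>

primrec mat_power :: "'a::semiring_1^'n^'n \<Rightarrow> nat \<Rightarrow> 'a^'n^'n" where
  "mat_power A 0 = mat 1"
| "mat_power A (Suc k) = A ** mat_power A k"

definition mat_spectrum :: "real^'n^'n \<Rightarrow> complex set" where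
  "mat_spectrum A = {\<mu>. \<not> invertible (mat \<mu> - map_matrix complex_of_real A)}"

definition block_mat ::
  "real^'c^'r \<Rightarrow> real^'d^'r \<Rightarrow> real^'c^'s \<Rightarrow> real^'d^'s \<Rightarrow> real^('c + 'd)^('r + 's)" where
  "block_mat P Q R T = (\<chi> p q. case p of
       Inl i \<Rightarrow> (case q of Inl j \<Rightarrow> P $ i $ j | Inr j \<Rightarrow> Q $ i $ j)
     | Inr i \<Rightarrow> (case q of Inl j \<Rightarrow> R $ i $ j | Inr j \<Rightarrow> T $ i $ j))"

definition cross_block :: "('n::finite \<Rightarrow> real^3) \<Rightarrow> real^('n \<times> 3)^('n \<times> 3)" where
  "cross_block m = (\<chi> p q. if fst p = fst q
     then matrix (cross3 (m (fst p))) $ snd p $ snd q else 0)"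

definition dot_block :: "('n::finite \<Rightarrow> real^3) \<Rightarrow> real^('n \<times> 3)^'n" where
  "dot_block m = (\<chi> i q. if i = fst q then m i $ snd q else 0)"

definition saddle_mat ::
  "real^('n \<times> 3)^('n \<times> 3) \<Rightarrow> ('n::finite \<Rightarrow> real^3) \<Rightarrow> real^('n \<times> 3 + 'n)^('n \<times> 3 + 'n)" where
  "saddle_mat H m = block_mat (H + cross_block m) (transpose (dot_block m)) (- dot_block m) 0"

definition herm_part :: "real^('n \<times> 3)^('n \<times> 3) \<Rightarrow> real^('n::finite \<times> 3 + 'n)^('n \<times> 3 + 'n)" where
  "herm_part H = block_mat H 0 0 0"

definition skew_part :: "('n::finite \<Rightarrow> real^3) \<Rightarrow> real^('n \<times> 3 + 'n)^('n \<times> 3 + 'n)" where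
  "skew_part m = block_mat (cross_block m) (transpose (dot_block m)) (- dot_block m) 0"

definition hss_precond ::
  "real \<Rightarrow> real^('n \<times> 3)^('n \<times> 3) \<Rightarrow> ('n::finite \<Rightarrow> real^3) \<Rightarrow> real^('n \<times> 3 + 'n)^('n \<times> 3 + 'n)" where
  "hss_precond lam H m = (mat lam + herm_part H) ** (mat lam + skew_part m)"

definition hss_mat ::
  "real \<Rightarrow> real^('n \<times> 3)^('n \<times> 3) \<Rightarrow> ('n::finite \<Rightarrow> real^3) \<Rightarrow> real^('n \<times> 3 + 'n)^('n \<times> 3 + 'n)" where
  "hss_mat lam H m = matrix_inv (mat lam + skew_part m) ** (mat lam - herm_part H)
     ** matrix_inv (mat lam + herm_part H) ** (mat lam - skew_part m)"

definition q_H :: "real \<Rightarrow> real^'k^'k \<Rightarrow> real" where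
  "q_H lam H = Max ((\<lambda>\<mu>. cmod ((of_real lam - \<mu>) / (of_real lam + \<mu>))) ` mat_spectrum H)"

definition gamma_m :: "real \<Rightarrow> ('n::finite \<Rightarrow> real^3) \<Rightarrow> real" where
  "gamma_m lam m = Min (range (\<lambda>i. 2 * lam * norm (m i) / (lam^2 + (norm (m i))^2)))"

definition theta2 :: "real \<Rightarrow> real^('n \<times> 3)^('n \<times> 3) \<Rightarrow> ('n::finite \<Rightarrow> real^3) \<Rightarrow> real" where
  "theta2 lam H m = sqrt (1 - (1 - (q_H lam H)^2) * (gamma_m lam m)^2
     / ((gamma_m lam m)^2 + 1 + (q_H lam H)^2))"

definition kappa :: "real \<Rightarrow> real \<Rightarrow> real \<Rightarrow> real" where
  "kappa lam mlo mhi = sqrt ((lam^2 + mhi^2) / (lam^2 + mlo^2))"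

definition skew_norm :: "real \<Rightarrow> ('n::finite \<Rightarrow> real^3) \<Rightarrow> real^('n \<times> 3 + 'n) \<Rightarrow> real" where
  "skew_norm lam m x = norm ((mat lam + skew_part m) *v x)"

text \<open>The sequence \<open>xh k\<close> holds the half-step iterates \<open>x\<^bsup>(k+1/2)\<^esup>\<close>.\<close>

definition hss_iteration ::
  "real \<Rightarrow> real^('n \<times> 3)^('n \<times> 3) \<Rightarrow> ('n::finite \<Rightarrow> real^3) \<Rightarrow> real^('n \<times> 3 + 'n)
   \<Rightarrow> (nat \<Rightarrow> real^('n \<times> 3 + 'n)) \<Rightarrow> (nat \<Rightarrow> real^('n \<times> 3 + 'n)) \<Rightarrow> bool" where
  "hss_iteration lam H m b x xh \<longleftrightarrow> (\<forall>k.
     (herm_part H + mat lam) *v xh k = (mat lam - skew_part m) *v x k + b \<and>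
     (skew_part m + mat lam) *v x (Suc k) = (mat lam - herm_part H) *v xh k + b)"

definition prec_residual :: "real^'k^'k \<Rightarrow> real^'k^'k \<Rightarrow> real^'k \<Rightarrow> real^'k \<Rightarrow> real^'k" where
  "prec_residual M A b x = matrix_inv M *v (b - A *v x)"

definition krylov :: "real^'k^'k \<Rightarrow> real^'k \<Rightarrow> nat \<Rightarrow> (real^'k) set" where
  "krylov P r j = span ((\<lambda>i. mat_power P i *v r) ` {..<j})"

definition gmres_iterate ::
  "real^'k^'k \<Rightarrow> real^'k^'k \<Rightarrow> real^'k \<Rightarrow> real^'k \<Rightarrow> nat \<Rightarrow> real^'k \<Rightarrow> bool" where
  "gmres_iterate M A b x0 j x \<longleftrightarrow> is_arg_min (\<lambda>y. norm (prec_residual M A b y))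
     (\<lambda>y. y \<in> (+) x0 ` krylov (matrix_inv M ** A) (prec_residual M A b x0) j) x"

end

theory Submission
  imports Defs "HOL-Probability.Characteristic_Functions"
begin

text \<open>
  In the norm \<open>\<parallel>(\<lambda> + S) x\<parallel>\<close> one HSS step is \<open>Q U\<close>, with \<open>U = (\<lambda> - S) (\<lambda> + S)\<inverse>\<close> orthogonal because \<open>S\<close>
  is skew, and \<open>Q = (\<lambda> - H) (\<lambda> + H)\<inverse>\<close> shrinking velocities by the factor \<open>q\<close> and fixing multipliers.
  Two steps therefore lose at least \<open>(1 - q\<^sup>2) (a\<^sup>2 + d\<^sup>2)\<close> of the squared norm, \<open>a\<close> and \<open>d\<close> being the velocity
  norms after the first and second application of \<open>U\<close>. The velocity-multiplier block of \<open>U\<close>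
  is bounded below by \<open>\<gamma>\<close>, so the multiplier norm \<open>c\<close> after the first step satisfies
  \<open>\<gamma> c \<le> d + q a\<close>, and Cauchy-Schwarz gives \<open>\<gamma>\<^sup>2 (a\<^sup>2 + c\<^sup>2) \<le> (\<gamma>\<^sup>2 + 1 + q\<^sup>2) (a\<^sup>2 + d\<^sup>2)\<close>.
  For GMRES, the iteration matrix equals \<open>1 - 2 \<lambda> M\<inverse> A\<close>, so its powers are admissible residual
  polynomials; \<open>\<kappa>\<close> is the cost of changing norms.
\<close>

section \<open>Real symmetric positive definite matrices\<close>

lemma invertible_iff_ker: "invertible A \<longleftrightarrow> (\<forall>x. A *v x = 0 \<longrightarrow> x = 0)"
  for A :: "'a::field^'n^'n"
  by (simp add: invertible_left_inverse matrix_left_invertible_ker)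

lemma matrix_inv_cancel:
  fixes A :: "'a::field^'n^'n"
  assumes "invertible A"
  shows "matrix_inv A *v (A *v x) = x" "A *v (matrix_inv A *v x) = x"
proof -
  have "A ** matrix_inv A = mat 1 \<and> matrix_inv A ** A = mat 1"
    using assms unfolding invertible_def matrix_inv_def by (rule someI_ex)
  then show "matrix_inv A *v (A *v x) = x" "A *v (matrix_inv A *v x) = x"
    by (simp_all add: matrix_vector_mul_assoc)
qed

lemma mat_mult_vec: "mat c *v x = c *\<^sub>R x" for x :: "real^'n"
  by (simp add: vec_eq_iff matrix_vector_mult_def mat_def if_distrib[of "\<lambda>a. a * _"] sum.delta cong: if_cong)

lemma mat_mult_vec_complex: "mat c *v x = c *s x" for x :: "complex^'n"
  by (simp add: vec_eq_iff matrix_vector_mult_def mat_def if_distrib[of "\<lambda>a. a * _"] sum.delta cong: if_cong)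

lemma symmetric_matrix_dot:
  fixes H :: "real^'n^'n"
  assumes "transpose H = H"
  shows "x \<bullet> (H *v y) = (H *v x) \<bullet> y"
  by (metis assms dot_lmul_matrix vector_transpose_matrix)

section \<open>The spectrum of a symmetric matrix\<close>

definition real_eigenvalues :: "real^'n^'n \<Rightarrow> real set" where
  "real_eigenvalues A = {a. \<exists>v. v \<noteq> 0 \<and> A *v v = a *\<^sub>R v}"

text \<open>Splitting a complex eigenvector into real and imaginary parts, symmetry forces the
  eigenvalue to be real, and whichever part is nonzero is a real eigenvector. This turns the complex
  set in \<open>q_H\<close> into one accessible to real variational arguments.\<close>

lemma mat_spectrum_symmetric:
  fixes H :: "real^'n^'n"
  assumes sym: "transpose H = H"
  shows "mat_spectrum H = complex_of_real ` real_eigenvalues H"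
proof (intro set_eqI iffI)
  fix \<mu> assume "\<mu> \<in> mat_spectrum H"
  then obtain z where z: "z \<noteq> 0" "(mat \<mu> - map_matrix complex_of_real H) *v z = 0"
    by (auto simp: mat_spectrum_def invertible_iff_ker)
  then have e: "map_matrix complex_of_real H *v z = \<mu> *s z"
    by (simp add: matrix_vector_mult_diff_rdistrib mat_mult_vec_complex)
  define u v where "u = (\<chi> i. Re (z $ i))" and "v = (\<chi> i. Im (z $ i))"
  have "(H *v u) $ i = Re ((map_matrix complex_of_real H *v z) $ i)" for i
    by (simp add: u_def matrix_vector_mult_def map_matrix_def)
  then have hu: "H *v u = Re \<mu> *\<^sub>R u - Im \<mu> *\<^sub>R v"
    by (simp add: e vec_eq_iff u_def v_def)
  have "(H *v v) $ i = Im ((map_matrix complex_of_real H *v z) $ i)" for i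
    by (simp add: v_def matrix_vector_mult_def map_matrix_def)
  then have hv: "H *v v = Re \<mu> *\<^sub>R v + Im \<mu> *\<^sub>R u"
    by (simp add: e vec_eq_iff u_def v_def)
  have nz: "u \<noteq> 0 \<or> v \<noteq> 0"
    using z(1) by (auto simp: u_def v_def vec_eq_iff complex_eq_iff)
  have "v \<bullet> (H *v u) = (H *v v) \<bullet> u"
    by (rule symmetric_matrix_dot[OF sym])
  \<comment> \<open>The two sides are
    \<open>Re \<mu> * (v \<bullet> u) - Im \<mu> * (v \<bullet> v)\<close> and
    \<open>Re \<mu> * (v \<bullet> u) + Im \<mu> * (u \<bullet> u)\<close>.\<close>
  then have "Im \<mu> * (u \<bullet> u + v \<bullet> v) = 0"
    by (simp add: hu hv inner_simps inner_commute algebra_simps)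
  moreover have "u \<bullet> u + v \<bullet> v > 0"
    using nz by (auto intro: add_pos_nonneg add_nonneg_pos)
  ultimately have im: "Im \<mu> = 0" by auto
  then have "Re \<mu> \<in> real_eigenvalues H"
    using nz hu hv by (auto simp: real_eigenvalues_def)
  moreover have "\<mu> = complex_of_real (Re \<mu>)"
    using im by (simp add: complex_eq_iff)
  ultimately show "\<mu> \<in> complex_of_real ` real_eigenvalues H" by blast
next
  fix \<mu> assume "\<mu> \<in> complex_of_real ` real_eigenvalues H"
  then obtain a v where a: "\<mu> = complex_of_real a" "v \<noteq> 0" "H *v v = a *\<^sub>R v"
    by (auto simp: real_eigenvalues_def)
  define z where "z = (\<chi> i. complex_of_real (v $ i))"
  have "(map_matrix complex_of_real H *v z) $ i = complex_of_real ((H *v v) $ i)" for i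
    by (simp add: z_def matrix_vector_mult_def map_matrix_def)
  then have "(mat \<mu> - map_matrix complex_of_real H) *v z = 0"
    by (simp add: matrix_vector_mult_diff_rdistrib mat_mult_vec_complex vec_eq_iff a z_def)
  moreover have "z \<noteq> 0"
    using a(2) by (simp add: z_def vec_eq_iff)
  ultimately show "\<mu> \<in> mat_spectrum H"
    by (auto simp: mat_spectrum_def invertible_iff_ker)
qed

text \<open>Eigenvectors of distinct eigenvalues are orthogonal, and a pairwise orthogonal family in
  finite dimension is finite. Finiteness makes the \<open>Max\<close> in \<open>q_H\<close> a
  genuine maximum.\<close>

lemma finite_real_eigenvalues:
  fixes H :: "real^'n^'n"
  assumes sym: "transpose H = H"
  shows "finite (real_eigenvalues H)"
proof -
  have "\<forall>a\<in>real_eigenvalues H. \<exists>v. v \<noteq> 0 \<and> H *v v = a *\<^sub>R v"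
    by (simp add: real_eigenvalues_def)
  from bchoice[OF this] obtain f
    where f: "\<And>a. a \<in> real_eigenvalues H \<Longrightarrow> f a \<noteq> 0 \<and> H *v f a = a *\<^sub>R f a"
    by blast
  have orth: "f a \<bullet> f b = 0" if "a \<in> real_eigenvalues H" "b \<in> real_eigenvalues H" "a \<noteq> b" for a b
    using symmetric_matrix_dot[OF sym, of "f a" "f b"] f[OF that(1)] f[OF that(2)] that(3) by simp
  have inj: "inj_on f (real_eigenvalues H)"
  proof (rule inj_onI, rule ccontr)
    fix a b assume ab: "a \<in> real_eigenvalues H" "b \<in> real_eigenvalues H" "f a = f b" "a \<noteq> b"
    then have "f a \<bullet> f a = 0" using orth[of a b] by simp
    then show False using f[OF ab(1)] by simp
  qed
  have "pairwise orthogonal (f ` real_eigenvalues H)"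
    using orth by (auto simp: pairwise_def orthogonal_def)
  then have "finite (f ` real_eigenvalues H)"
    by (rule pairwise_orthogonal_imp_finite)
  then show ?thesis
    using inj finite_imageD by blast
qed

text \<open>First-order optimality: for small \<open>t\<close> of the right sign a nonzero linear
  term would dominate the quadratic one. It yields the Euler-Lagrange equation of a
  maximiser.\<close>

lemma nonneg_quadratic_linear_coeff_zero:
  fixes b f :: real
  assumes "\<And>t. 0 \<le> 2 * t * b + t\<^sup>2 * f"
  shows "b = 0"
proof (rule ccontr)
  assume "b \<noteq> 0"
  define k where "k = \<bar>f\<bar> + 1"
  have k: "k > 0" "f < k" by (auto simp: k_def)
  have "0 \<le> 2 * (- b / k) * b + (- b / k)\<^sup>2 * f" by (rule assms)
  also have "\<dots> = b\<^sup>2 / k * (f / k - 2)"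
    using k by (simp add: field_simps power2_eq_square)
  also have "\<dots> < 0"
    using k \<open>b \<noteq> 0\<close> by (intro mult_pos_neg) (auto simp: field_simps)
  finally show False by simp
qed

text \<open>A maximiser of the quotient satisfies \<open>c (\<lambda> + H)\<^sup>2 v = (\<lambda> - H)\<^sup>2 v\<close>; factoring the
  difference of squares produces an eigenvector of \<open>H\<close>.\<close>

lemma cayley_extremal_eigenvalue:
  fixes H :: "real^'n^'n"
  assumes sym: "transpose H = H" and pos: "\<And>v. v \<noteq> 0 \<Longrightarrow> 0 < v \<bullet> (H *v v)" and lam: "0 < lam"
  obtains a where "a \<in> real_eigenvalues H"
    "\<And>u. norm (lam *\<^sub>R u - H *v u) \<le> \<bar>(lam - a) / (lam + a)\<bar> * norm (lam *\<^sub>R u + H *v u)"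
proof -
  define P where "P u = lam *\<^sub>R u + H *v u" for u
  define N where "N u = lam *\<^sub>R u - H *v u" for u
  have P_lin: "linear P" and N_lin: "linear N"
    unfolding P_def N_def
    by (auto intro!: linearI simp: matrix_vector_right_distrib matrix_vector_mult_scaleR algebra_simps)
  have P_self: "P x \<bullet> y = x \<bullet> P y" and N_self: "N x \<bullet> y = x \<bullet> N y" for x y
    by (simp_all add: P_def N_def inner_simps symmetric_matrix_dot[OF sym])
  have P_nz: "P u \<noteq> 0" if "u \<noteq> 0" for u
  proof
    assume "P u = 0"
    moreover have "u \<bullet> P u = lam * (u \<bullet> u) + u \<bullet> (H *v u)"
      by (simp add: P_def inner_simps)
    moreover have "lam * (u \<bullet> u) > 0" using that lam by simp
    ultimately show False using pos[OF that] by simp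
  qed
  \<comment> \<open>The quotient is invariant under scaling, so its supremum over all nonzero
    vectors is attained on the compact unit sphere.\<close>
  let ?S = "sphere (0::real^'n) 1"
  have sphere_nz: "u \<noteq> 0" if "u \<in> ?S" for u using that by auto
  have cont: "continuous_on ?S (\<lambda>u. (norm (N u))\<^sup>2 / (norm (P u))\<^sup>2)"
    using P_nz linear_continuous_on[OF linear_conv_bounded_linear[THEN iffD1, OF P_lin]]
      linear_continuous_on[OF linear_conv_bounded_linear[THEN iffD1, OF N_lin]]
    by (intro continuous_intros) (simp_all add: sphere_nz P_nz)
  have "?S \<noteq> {}" by simp
  then obtain v where v: "v \<in> ?S" and
    vmax: "\<And>u. u \<in> ?S \<Longrightarrow> (norm (N u))\<^sup>2 / (norm (P u))\<^sup>2 \<le> (norm (N v))\<^sup>2 / (norm (P v))\<^sup>2"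
    using continuous_attains_sup[OF compact_sphere _ cont] by blast
  define s where "s = norm (N v) / norm (P v)"
  have v_nz: "v \<noteq> 0" using v by auto
  have s0: "s \<ge> 0" by (simp add: s_def)
  have le: "(norm (N u))\<^sup>2 \<le> s\<^sup>2 * (norm (P u))\<^sup>2" for u
  proof (cases "u = 0")
    case False
    let ?u = "(1 / norm u) *\<^sub>R u"
    have "(norm (N ?u))\<^sup>2 / (norm (P ?u))\<^sup>2 \<le> s\<^sup>2"
      using vmax[of ?u] False by (simp add: s_def power_divide)
    moreover have "norm (N ?u) = norm (N u) / norm u" "norm (P ?u) = norm (P u) / norm u"
      by (simp_all add: linear_cmul[OF N_lin] linear_cmul[OF P_lin])
    ultimately show ?thesis
      using False P_nz[OF False] by (simp add: field_simps)
  qed (simp add: linear_0[OF N_lin])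
  have N_v: "(norm (N v))\<^sup>2 = s\<^sup>2 * (norm (P v))\<^sup>2"
    using P_nz[OF v_nz] by (simp add: s_def power_divide)
  \<comment> \<open>The quadratic form
    \<open>s\<^sup>2 * (norm (P u))\<^sup>2 - (norm (N u))\<^sup>2\<close> is nonnegative and
    vanishes at \<open>v\<close>, so its first variation there is zero in every direction.\<close>
  have ker: "s\<^sup>2 * (P v \<bullet> P u) - N v \<bullet> N u = 0" for u
  proof (rule nonneg_quadratic_linear_coeff_zero)
    fix t :: real
    have "0 \<le> s\<^sup>2 * (norm (P (v + t *\<^sub>R u)))\<^sup>2 - (norm (N (v + t *\<^sub>R u)))\<^sup>2"
      using le[of "v + t *\<^sub>R u"] by simp
    also have "\<dots> = 2 * t * (s\<^sup>2 * (P v \<bullet> P u) - N v \<bullet> N u)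
        + t\<^sup>2 * (s\<^sup>2 * (P u \<bullet> P u) - N u \<bullet> N u)"
      using N_v unfolding linear_add[OF P_lin] linear_add[OF N_lin] linear_cmul[OF P_lin] linear_cmul[OF N_lin]
        power2_norm_eq_inner
      by (simp add: inner_simps inner_commute algebra_simps power2_eq_square)
    finally show "0 \<le> 2 * t * (s\<^sup>2 * (P v \<bullet> P u) - N v \<bullet> N u)
        + t\<^sup>2 * (s\<^sup>2 * (P u \<bullet> P u) - N u \<bullet> N u)" .
  qed
  have sq: "s\<^sup>2 *\<^sub>R P (P v) = N (N v)"
  proof -
    have "(s\<^sup>2 *\<^sub>R P (P v) - N (N v)) \<bullet> u = 0" for u
      using ker[of u] by (simp add: inner_simps P_self N_self)
    then have "s\<^sup>2 *\<^sub>R P (P v) - N (N v) = 0" by (rule inner_eq_zero_iff[THEN iffD1])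
    then show ?thesis by simp
  qed
  have NP: "N (P v) = P (N v)"
    by (simp add: P_def N_def matrix_vector_right_distrib matrix_vector_mult_diff_distrib
        matrix_vector_mult_scaleR algebra_simps)
  \<comment> \<open>Since \<open>N\<close> and \<open>P\<close> commute, \<open>sq\<close> reads
    \<open>(s P - N) (s P + N) v = 0\<close>. Either \<open>v\<close> is already in the kernel of
    \<open>s P + N\<close>, giving \<open>t = - s\<close>, or \<open>(s P + N) v\<close> is a
    nonzero vector in the kernel of \<open>s P - N\<close>, giving \<open>t = s\<close>.\<close>
  obtain w t where w: "w \<noteq> 0" "N w = t *\<^sub>R P w" "\<bar>t\<bar> = s"
  proof (cases "s *\<^sub>R P v + N v = 0")
    case True
    then have "N v = (- s) *\<^sub>R P v" by (simp add: add_eq_0_iff)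
    with v_nz s0 show ?thesis by (intro that[of v "- s"]) auto
  next
    case False
    have "N (s *\<^sub>R P v + N v) = s *\<^sub>R P (s *\<^sub>R P v + N v)"
      unfolding linear_add[OF P_lin] linear_add[OF N_lin] linear_cmul[OF P_lin] linear_cmul[OF N_lin] NP
      using sq by (simp add: algebra_simps power2_eq_square)
    with False s0 show ?thesis by (intro that[of "s *\<^sub>R P v + N v" s]) auto
  qed
  have t1: "(1 + t) *\<^sub>R (H *v w) = (lam * (1 - t)) *\<^sub>R w"
    using w(2) by (simp add: P_def N_def algebra_simps)
  have tn: "1 + t \<noteq> 0"
  proof
    assume "1 + t = 0"
    then have "t = -1" by simp
    with t1 w(1) lam show False by simp
  qed
  \<comment> \<open>The value solves \<open>(lam - a) / (lam + a) = t\<close>, inverting the scalar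
    Cayley transform.\<close>
  define a where "a = lam * (1 - t) / (1 + t)"
  have "H *v w = (1 / (1 + t)) *\<^sub>R ((1 + t) *\<^sub>R (H *v w))" using tn by simp
  also have "\<dots> = a *\<^sub>R w" unfolding t1 by (simp add: a_def)
  finally have aw: "H *v w = a *\<^sub>R w" .
  have "lam + a = 2 * lam / (1 + t)" "lam - a = 2 * lam * t / (1 + t)"
    using tn by (simp_all add: a_def field_simps)
  then have "(lam - a) / (lam + a) = t" using lam tn by simp
  then have as: "\<bar>(lam - a) / (lam + a)\<bar> = s" using w(3) by simp
  show ?thesis
  proof
    show "a \<in> real_eigenvalues H" using w(1) aw by (auto simp: real_eigenvalues_def)
    have "norm (N u) \<le> s * norm (P u)" for u
      by (rule power2_le_imp_le) (use le[of u] s0 in \<open>simp_all add: power_mult_distrib\<close>)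
    then show "norm (lam *\<^sub>R u - H *v u) \<le> \<bar>(lam - a) / (lam + a)\<bar> * norm (lam *\<^sub>R u + H *v u)" for u
      by (simp only: as P_def N_def)
  qed
qed

lemma real_eigenvalues_pos:
  assumes "\<And>v. v \<noteq> 0 \<Longrightarrow> 0 < v \<bullet> (H *v v)" "a \<in> real_eigenvalues H"
  shows "0 < a"
proof -
  obtain v where v: "v \<noteq> 0" "H *v v = a *\<^sub>R v"
    using assms(2) by (auto simp: real_eigenvalues_def)
  then have "0 < a * (v \<bullet> v)" using assms(1)[OF v(1)] by simp
  then show ?thesis using inner_ge_zero[of v] by (simp add: zero_less_mult_iff)
qed

text \<open>The extremal eigenvalue from \<open>cayley_extremal_eigenvalue\<close> competes in the
  maximum, so \<open>q_H\<close> dominates its factor; positivity of the eigenvalues puts every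
  factor below 1. With \<open>u\<close> replaced by a preimage under \<open>lam + H\<close>, the
  third claim bounds the norm of the Cayley transform of \<open>H\<close> without mentioning an
  inverse.\<close>

lemma
  fixes H :: "real^'n^'n"
  assumes sym: "transpose H = H" and pos: "\<And>v. v \<noteq> 0 \<Longrightarrow> 0 < v \<bullet> (H *v v)" and lam: "0 < lam"
  shows q_H_nonneg: "0 \<le> q_H lam H"
    and q_H_less_1: "q_H lam H < 1"
    and q_H_bound: "norm (lam *\<^sub>R u - H *v u) \<le> q_H lam H * norm (lam *\<^sub>R u + H *v u)"
proof -
  let ?f = "\<lambda>a. \<bar>(lam - a) / (lam + a)\<bar>"
  have "cmod ((of_real lam - of_real a) / (of_real lam + of_real a)) = ?f a" for a
    by (metis norm_of_real of_real_add of_real_diff of_real_divide)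
  then have q: "q_H lam H = Max (?f ` real_eigenvalues H)"
    by (simp add: q_H_def mat_spectrum_symmetric[OF sym] image_image)
  have fin: "finite (?f ` real_eigenvalues H)"
    using finite_real_eigenvalues[OF sym] by simp
  obtain a where a: "a \<in> real_eigenvalues H"
    and bound: "\<And>u. norm (lam *\<^sub>R u - H *v u) \<le> ?f a * norm (lam *\<^sub>R u + H *v u)"
    using cayley_extremal_eigenvalue[OF sym pos lam] by blast
  have fa: "?f a \<le> q_H lam H"
    unfolding q using a fin by (intro Max_ge) auto
  then show "0 \<le> q_H lam H" by (rule order_trans[rotated]) simp
  show "norm (lam *\<^sub>R u - H *v u) \<le> q_H lam H * norm (lam *\<^sub>R u + H *v u)"
    using bound[of u] mult_right_mono[OF fa norm_ge_zero] by (rule order_trans)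
  have "?f a < 1" if "a \<in> real_eigenvalues H" for a
    using real_eigenvalues_pos[OF pos that] lam by (simp add: abs_less_iff field_simps)
  then show "q_H lam H < 1"
    unfolding q using fin a by (subst Max_less_iff) auto
qed

section \<open>Block structure\<close>

definition vpart :: "real^('a::finite + 'b::finite) \<Rightarrow> real^'a" where
  "vpart x = (\<chi> i. x $ Inl i)"

definition rpart :: "real^('a::finite + 'b::finite) \<Rightarrow> real^'b" where
  "rpart x = (\<chi> i. x $ Inr i)"

definition node :: "real^('n \<times> 3) \<Rightarrow> 'n::finite \<Rightarrow> real^3" where
  "node v i = (\<chi> k. v $ (i, k))"

lemma vpart_simps [simp]:
  "vpart (x + y) = vpart x + vpart y" "vpart (x - y) = vpart x - vpart y"
  "vpart (c *\<^sub>R x) = c *\<^sub>R vpart x" "vpart 0 = 0"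
  by (simp_all add: vpart_def vec_eq_iff)

lemma rpart_simps [simp]:
  "rpart (x + y) = rpart x + rpart y" "rpart (x - y) = rpart x - rpart y"
  "rpart (c *\<^sub>R x) = c *\<^sub>R rpart x" "rpart 0 = 0"
  by (simp_all add: rpart_def vec_eq_iff)

lemma node_simps [simp]:
  "node (x + y) i = node x i + node y i" "node (x - y) i = node x i - node y i"
  "node (c *\<^sub>R x) i = c *\<^sub>R node x i" "node 0 i = 0"
  by (simp_all add: node_def vec_eq_iff)

lemma sum_UNIV_Plus: "(\<Sum>i\<in>UNIV. f i) = (\<Sum>i\<in>UNIV. f (Inl i)) + (\<Sum>j\<in>UNIV. f (Inr j))"
  for f :: "'a::finite + 'b::finite \<Rightarrow> 'c::comm_monoid_add"
  by (simp flip: UNIV_Plus_UNIV add: sum.Plus)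

lemma sum_UNIV_Times: "(\<Sum>p\<in>UNIV. f p) = (\<Sum>i\<in>UNIV. \<Sum>k\<in>UNIV. f (i, k))"
  for f :: "'a::finite \<times> 'b::finite \<Rightarrow> 'c::comm_monoid_add"
  by (simp flip: UNIV_Times_UNIV add: sum.cartesian_product)

text \<open>Collapses a row sum of a block diagonal matrix to the one block that can be
  nonzero.\<close>

lemma sum_UNIV_node:
  fixes f :: "'a::finite \<times> 'b::finite \<Rightarrow> 'c::comm_monoid_add"
  assumes "\<And>j k. j \<noteq> i \<Longrightarrow> f (j, k) = 0"
  shows "(\<Sum>p\<in>UNIV. f p) = (\<Sum>k\<in>UNIV. f (i, k))"
proof -
  have "(\<Sum>p\<in>UNIV. f p) = (\<Sum>j\<in>UNIV. if j = i then \<Sum>k\<in>UNIV. f (j, k) else 0)"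
    unfolding sum_UNIV_Times using assms by (intro sum.cong) auto
  then show ?thesis by (simp add: sum.delta)
qed

lemma inner_parts: "x \<bullet> y = vpart x \<bullet> vpart y + rpart x \<bullet> rpart y"
  by (simp add: inner_vec_def vpart_def rpart_def sum_UNIV_Plus)

lemma norm_parts: "(norm x)\<^sup>2 = (norm (vpart x))\<^sup>2 + (norm (rpart x))\<^sup>2"
  by (simp add: power2_norm_eq_inner inner_parts)

lemma parts_eq_0_iff: "x = 0 \<longleftrightarrow> vpart x = 0 \<and> rpart x = 0"
  by (metis add_cancel_right_right norm_eq_zero norm_parts power_zero_numeral vpart_simps(4) rpart_simps(4) zero_eq_power2)

lemma inner_nodes: "v \<bullet> w = (\<Sum>i\<in>UNIV. node v i \<bullet> node w i)"
  by (simp add: inner_vec_def node_def sum_UNIV_Times)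

lemma norm_nodes: "norm v = L2_set (\<lambda>i. norm (node v i)) UNIV"
  by (simp add: norm_eq_sqrt_inner[of v] inner_nodes L2_set_def power2_norm_eq_inner)

lemma block_mat_mult_vec:
  "vpart (block_mat P Q R T *v x) = P *v vpart x + Q *v rpart x"
  "rpart (block_mat P Q R T *v x) = R *v vpart x + T *v rpart x"
  by (simp_all add: vec_eq_iff vpart_def rpart_def matrix_vector_mult_def block_mat_def sum_UNIV_Plus)

lemma node_cross_block: "node (cross_block m *v v) i = cross3 (m i) (node v i)"
proof -
  have "linear (cross3 (m i))"
    using bilinear_cross by (simp add: bilinear_def)
  then have "matrix (cross3 (m i)) *v node v i = cross3 (m i) (node v i)"
    by (simp add: matrix_works linear_conv_bounded_linear)
  moreover have "(\<Sum>q\<in>UNIV. cross_block m $ (i, k) $ q * v $ q)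
      = (\<Sum>l\<in>UNIV. cross_block m $ (i, k) $ (i, l) * v $ (i, l))" for k
    by (rule sum_UNIV_node) (simp add: cross_block_def)
  ultimately show ?thesis
    by (simp add: vec_eq_iff node_def matrix_vector_mult_def) (simp add: cross_block_def)
qed

lemma node_transpose_dot_block: "node (transpose (dot_block m) *v r) i = r $ i *\<^sub>R m i"
  by (simp add: vec_eq_iff node_def matrix_vector_mult_def dot_block_def transpose_def
      if_distribR if_distrib[of "\<lambda>a. a * _"] cong: if_cong)

lemma dot_block_mult_vec: "(dot_block m *v v) $ i = m i \<bullet> node v i"
  unfolding node_def matrix_vector_mult_def dot_block_def inner_vec_def
  by (subst vec_lambda_beta, subst sum_UNIV_node[where i = i]) auto

lemma skew_part_mult_vec:
  "node (vpart (skew_part m *v x)) i = cross3 (m i) (node (vpart x) i) + rpart x $ i *\<^sub>R m i"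
  "rpart (skew_part m *v x) $ i = - (m i \<bullet> node (vpart x) i)"
proof -
  have "((- dot_block m) *v v) $ i = - (dot_block m *v v) $ i" for v
    by (simp add: matrix_vector_mult_def sum_negf)
  then show "rpart (skew_part m *v x) $ i = - (m i \<bullet> node (vpart x) i)"
    by (simp add: skew_part_def block_mat_mult_vec dot_block_mult_vec)
qed (simp add: skew_part_def block_mat_mult_vec node_cross_block node_transpose_dot_block
    del: transpose_matrix_vector)

lemma herm_part_mult_vec [simp]:
  "vpart (herm_part H *v x) = H *v vpart x" "rpart (herm_part H *v x) = 0"
  by (simp_all add: herm_part_def block_mat_mult_vec)

lemma saddle_mat_eq: "saddle_mat H m = herm_part H + skew_part m"
  by (auto simp: vec_eq_iff saddle_mat_def herm_part_def skew_part_def block_mat_def split: sum.split)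

text \<open>At each node \<open>m \<times> a\<close> is orthogonal to \<open>a\<close>, and the two
  coupling terms \<open>r (m \<bullet> a)\<close> cancel. This is the form in which skewness is
  used.\<close>

lemma inner_skew_part: "x \<bullet> (skew_part m *v x) = 0"
  by (simp add: inner_parts inner_nodes skew_part_mult_vec inner_vec_def[of "rpart x"] inner_simps
      dot_cross_self inner_commute mult.commute sum_negf)

text \<open>Node by node \<open>S\<^sup>T S = \<parallel>m\<^sub>i\<parallel>\<^sup>2 I\<close>.\<close>

lemma norm_skew_part:
  "(norm (skew_part m *v x))\<^sup>2 = (\<Sum>i\<in>UNIV. (norm (m i))\<^sup>2 * ((norm (node (vpart x) i))\<^sup>2 + (rpart x $ i)\<^sup>2))"
proof -
  \<comment> \<open>The mixed term vanishes because \<open>m \<times> a\<close> is orthogonal to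
    \<open>m\<close>; Lagrange's identity for \<open>m \<times> a\<close> and
    \<open>m \<bullet> a\<close> does the rest.\<close>
  have "(norm (cross3 (m i) a + r *\<^sub>R m i))\<^sup>2 + (m i \<bullet> a)\<^sup>2 = (norm (m i))\<^sup>2 * ((norm a)\<^sup>2 + r\<^sup>2)"
    for i r and a :: "real^3"
  proof -
    have "(norm (cross3 (m i) a + r *\<^sub>R m i))\<^sup>2 = (norm (cross3 (m i) a))\<^sup>2 + r\<^sup>2 * (norm (m i))\<^sup>2"
      unfolding power2_norm_eq_inner
      by (simp add: inner_add_left inner_add_right dot_cross_self power2_eq_square[of r])
    with norm_cross_dot[of "m i" a] show ?thesis
      by (simp add: power_mult_distrib algebra_simps)
  qed
  then show ?thesis
    by (simp add: norm_parts norm_nodes L2_set_def norm_vec_def[of "rpart _"] skew_part_mult_vec sum_nonneg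
        flip: sum.distrib)
qed

lemma norm_full: "(norm x)\<^sup>2 = (\<Sum>i\<in>UNIV. (norm (node (vpart x) i))\<^sup>2 + (rpart x $ i)\<^sup>2)"
  by (simp add: norm_parts norm_nodes L2_set_def norm_vec_def[of "rpart _"] sum_nonneg sum.distrib)

section \<open>The Cayley transform of the skew part\<close>

lemma shifted_skew_part:
  "(mat lam + skew_part m) *v x = lam *\<^sub>R x + skew_part m *v x"
  "(mat lam - skew_part m) *v x = lam *\<^sub>R x - skew_part m *v x"
  "(mat lam + herm_part H) *v x = lam *\<^sub>R x + herm_part H *v x"
  "(mat lam - herm_part H) *v x = lam *\<^sub>R x - herm_part H *v x"
  by (simp_all add: matrix_vector_mult_add_rdistrib matrix_vector_mult_diff_rdistrib mat_mult_vec)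

lemma norm_shifted_skew_part:
  "(norm ((mat lam + skew_part m) *v x))\<^sup>2 = lam\<^sup>2 * (norm x)\<^sup>2 + (norm (skew_part m *v x))\<^sup>2"
  "(norm ((mat lam - skew_part m) *v x))\<^sup>2 = lam\<^sup>2 * (norm x)\<^sup>2 + (norm (skew_part m *v x))\<^sup>2"
  using inner_skew_part[of x m]
  unfolding shifted_skew_part power2_norm_eq_inner
  by (simp_all add: inner_add_left inner_add_right inner_diff_left inner_diff_right inner_commute
      power2_eq_square[of lam])

text \<open>Orthogonality of the Cayley transform, stated without an inverse: the mixed terms
  \<open>2 * lam * (x \<bullet> S x)\<close> vanish for both signs.\<close>

lemma norm_cayley: "norm ((mat lam - skew_part m) *v x) = norm ((mat lam + skew_part m) *v x)"
  by (metis norm_shifted_skew_part norm_ge_zero power2_eq_iff_nonneg)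

text \<open>On node \<open>i\<close> the Cayley transform \<open>w\<close> of \<open>z\<close> satisfies
  \<open>2 \<lambda> \<parallel>m\<parallel>\<^sup>2 z\<^sub>r = m \<bullet> ((\<lambda>\<^sup>2 - \<parallel>m\<parallel>\<^sup>2) z\<^sub>v - (\<lambda>\<^sup>2 + \<parallel>m\<parallel>\<^sup>2) w\<^sub>v)\<close>.\<close>

lemma cayley_node_bound:
  fixes m a :: "real^3" and r lam :: real
  assumes lam: "0 < lam" and m: "m \<noteq> 0"
  defines "zv \<equiv> lam *\<^sub>R a + (cross3 m a + r *\<^sub>R m)"
    and "zr \<equiv> lam * r - m \<bullet> a"
    and "wv \<equiv> lam *\<^sub>R a - (cross3 m a + r *\<^sub>R m)"
  shows "2 * lam * norm m / (lam\<^sup>2 + (norm m)\<^sup>2) * \<bar>zr\<bar> \<le> norm wv + norm zv"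
proof -
  let ?n = "norm m"
  have n: "?n > 0" using m by simp
  have d: "lam\<^sup>2 + ?n\<^sup>2 > 0" using lam by (simp add: add_pos_nonneg)
  have mz: "m \<bullet> zv = lam * (m \<bullet> a) + r * ?n\<^sup>2" and mw: "m \<bullet> wv = lam * (m \<bullet> a) - r * ?n\<^sup>2"
    unfolding zv_def wv_def power2_norm_eq_inner
    by (simp_all add: inner_add_right inner_diff_right dot_cross_self)
  \<comment> \<open>The sum and the difference of \<open>mz\<close> and \<open>mw\<close> determine
    \<open>m \<bullet> a\<close> and \<open>r\<close>, hence \<open>zr\<close>.\<close>
  have "2 * lam * ?n\<^sup>2 * zr = m \<bullet> ((lam\<^sup>2 - ?n\<^sup>2) *\<^sub>R zv - (lam\<^sup>2 + ?n\<^sup>2) *\<^sub>R wv)"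
    unfolding inner_diff_right inner_scaleR_right mz mw zr_def by algebra
  then have "2 * lam * ?n\<^sup>2 * \<bar>zr\<bar> = \<bar>m \<bullet> ((lam\<^sup>2 - ?n\<^sup>2) *\<^sub>R zv - (lam\<^sup>2 + ?n\<^sup>2) *\<^sub>R wv)\<bar>"
    using lam by (simp add: abs_mult flip: \<open>2 * lam * ?n\<^sup>2 * zr = _\<close>)
  also have "\<dots> \<le> ?n * norm ((lam\<^sup>2 - ?n\<^sup>2) *\<^sub>R zv - (lam\<^sup>2 + ?n\<^sup>2) *\<^sub>R wv)"
    by (rule Cauchy_Schwarz_ineq2)
  also have "\<dots> \<le> ?n * (\<bar>lam\<^sup>2 - ?n\<^sup>2\<bar> * norm zv + (lam\<^sup>2 + ?n\<^sup>2) * norm wv)"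
    using n d norm_triangle_ineq4[of "(lam\<^sup>2 - ?n\<^sup>2) *\<^sub>R zv" "(lam\<^sup>2 + ?n\<^sup>2) *\<^sub>R wv"] by simp
  \<comment> \<open>Replacing \<open>\<bar>lam\<^sup>2 - ?n\<^sup>2\<bar>\<close> by
    \<open>lam\<^sup>2 + ?n\<^sup>2\<close> gives both norms the same weight, the denominator in the
    nodal quantity of \<open>gamma_m\<close>.\<close>
  also have "\<dots> \<le> ?n * ((lam\<^sup>2 + ?n\<^sup>2) * norm zv + (lam\<^sup>2 + ?n\<^sup>2) * norm wv)"
    by (intro mult_left_mono add_right_mono mult_right_mono) (auto simp: abs_le_iff)
  finally have "?n * (2 * lam * ?n * \<bar>zr\<bar>) \<le> ?n * ((lam\<^sup>2 + ?n\<^sup>2) * (norm wv + norm zv))"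
    by (simp add: algebra_simps power2_eq_square)
  then have "2 * lam * ?n * \<bar>zr\<bar> \<le> (lam\<^sup>2 + ?n\<^sup>2) * (norm wv + norm zv)"
    using n by simp
  then show ?thesis
    using d by (simp add: field_simps)
qed

context
  fixes m :: "'n::finite \<Rightarrow> real^3" and lam :: real
  assumes lam: "0 < lam" and m_nz: "\<And>i. m i \<noteq> 0"
begin

lemma gamma_m_le: "gamma_m lam m \<le> 2 * lam * norm (m i) / (lam\<^sup>2 + (norm (m i))\<^sup>2)"
  unfolding gamma_m_def by (intro Min_le) auto

lemma gamma_m_pos: "0 < gamma_m lam m"
  unfolding gamma_m_def using lam m_nz by (subst Min_gr_iff) (auto intro!: divide_pos_pos add_pos_pos)

text \<open>The nodal bounds, weakened to the worst node, are combined by Minkowski's inequality.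
  Parametrising by \<open>p\<close> lets \<open>w\<close> be the Cayley transform of
  \<open>z\<close> without writing an inverse.\<close>

lemma cayley_coupling:
  fixes p :: "real^('n \<times> 3 + 'n)"
  defines "z \<equiv> (mat lam + skew_part m) *v p" and "w \<equiv> (mat lam - skew_part m) *v p"
  shows "gamma_m lam m * norm (rpart z) \<le> norm (vpart w) + norm (vpart z)"
proof -
  have "gamma_m lam m * \<bar>rpart z $ i\<bar> \<le> norm (node (vpart w) i) + norm (node (vpart z) i)" for i
  proof -
    have "gamma_m lam m * \<bar>rpart z $ i\<bar> \<le> 2 * lam * norm (m i) / (lam\<^sup>2 + (norm (m i))\<^sup>2) * \<bar>rpart z $ i\<bar>"
      by (rule mult_right_mono[OF gamma_m_le]) simp
    also have "\<dots> \<le> norm (node (vpart w) i) + norm (node (vpart z) i)"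
      using cayley_node_bound[OF lam m_nz[of i], of "rpart p $ i" "node (vpart p) i"]
      by (simp add: z_def w_def shifted_skew_part skew_part_mult_vec)
    finally show ?thesis .
  qed
  then have "L2_set (\<lambda>i. gamma_m lam m * \<bar>rpart z $ i\<bar>) UNIV
      \<le> L2_set (\<lambda>i. norm (node (vpart w) i) + norm (node (vpart z) i)) UNIV"
    using gamma_m_pos by (intro L2_set_mono) auto
  also have "\<dots> \<le> norm (vpart w) + norm (vpart z)"
    unfolding norm_nodes by (rule L2_set_triangle_ineq)
  also have "L2_set (\<lambda>i. gamma_m lam m * \<bar>rpart z $ i\<bar>) UNIV = gamma_m lam m * norm (rpart z)"
    using gamma_m_pos by (simp add: L2_set_right_distrib norm_vec_def)
  finally show ?thesis .
qed

lemma invertible_shifted_skew_part: "invertible (mat lam + skew_part m)"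
proof -
  have "x = 0" if "(mat lam + skew_part m) *v x = 0" for x
  proof -
    have "lam\<^sup>2 * (norm x)\<^sup>2 + (norm (skew_part m *v x))\<^sup>2 = 0"
      using that by (metis norm_shifted_skew_part(1) norm_zero zero_power2)
    then show "x = 0" using lam by (simp add: add_nonneg_eq_0_iff)
  qed
  then show ?thesis by (auto simp: invertible_iff_ker)
qed

end

section \<open>Contraction of two HSS steps\<close>

lemma two_step_arith:
  fixes a c d g q :: real
  assumes q: "0 \<le> q" "q < 1" and g: "0 < g" and nn: "0 \<le> a" "0 \<le> c" "0 \<le> d"
    and coupling: "g * c \<le> d + q * a"
  shows "g\<^sup>2 / (g\<^sup>2 + 1 + q\<^sup>2) * (a\<^sup>2 + c\<^sup>2) \<le> a\<^sup>2 + d\<^sup>2"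
proof -
  have "g\<^sup>2 * c\<^sup>2 \<le> (d + q * a)\<^sup>2"
    using power_mono[OF coupling, of 2] g nn by (simp add: power_mult_distrib)
  \<comment> \<open>Cauchy-Schwarz for \<open>(1, q)\<close> and \<open>(d, a)\<close>, with its
    defect written as a square.\<close>
  also have "(d + q * a)\<^sup>2 + (q * d - a)\<^sup>2 = (1 + q\<^sup>2) * (a\<^sup>2 + d\<^sup>2)"
    by algebra
  then have "(d + q * a)\<^sup>2 \<le> (1 + q\<^sup>2) * (a\<^sup>2 + d\<^sup>2)"
    using zero_le_power2[of "q * d - a"] by linarith
  finally have "g\<^sup>2 * c\<^sup>2 \<le> (1 + q\<^sup>2) * (a\<^sup>2 + d\<^sup>2)" .
  \<comment> \<open>This term completes \<open>g\<^sup>2 * a\<^sup>2\<close> to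
    \<open>g\<^sup>2 * (a\<^sup>2 + d\<^sup>2)\<close>.\<close>
  moreover have "0 \<le> g\<^sup>2 * d\<^sup>2" by simp
  ultimately have "g\<^sup>2 * (a\<^sup>2 + c\<^sup>2) \<le> (g\<^sup>2 + 1 + q\<^sup>2) * (a\<^sup>2 + d\<^sup>2)"
    by (simp only: algebra_simps)
  moreover have "0 < g\<^sup>2 + 1 + q\<^sup>2" by (simp add: add_nonneg_pos add_pos_nonneg)
  ultimately show ?thesis by (simp add: field_simps)
qed

text \<open>Collects the data shared by the contraction, convergence and GMRES arguments; the
  quantitative bounds on the \<open>m i\<close> enter with the change of norms.\<close>

locale hss =
  fixes m :: "'n::finite \<Rightarrow> real^3" and H :: "real^('n \<times> 3)^('n \<times> 3)" and lam :: real
  assumes m_nz: "m i \<noteq> 0" and H_sym: "transpose H = H"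
    and H_pos: "v \<noteq> 0 \<Longrightarrow> 0 < v \<bullet> (H *v v)" and lam: "0 < lam"
begin

abbreviation "q \<equiv> q_H lam H"
abbreviation "\<gamma> \<equiv> gamma_m lam m"
abbreviation "\<theta> \<equiv> theta2 lam H m"
abbreviation "M \<equiv> hss_precond lam H m"
abbreviation "A \<equiv> saddle_mat H m"
abbreviation "T \<equiv> hss_mat lam H m"

lemmas q_props = q_H_nonneg[OF H_sym H_pos lam] q_H_less_1[OF H_sym H_pos lam]
lemmas q_bound = q_H_bound[OF H_sym H_pos lam]
lemmas \<gamma>_pos = gamma_m_pos[of lam m, OF lam m_nz]
lemmas invertible_skew = invertible_shifted_skew_part[of lam m, OF lam m_nz]

section \<open>Invertibility of the shifted parts, the preconditioner and the saddle-point
  matrix\<close>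

lemma invertible_herm: "invertible (mat lam + herm_part H)"
  unfolding invertible_iff_ker
proof (intro allI impI)
  fix x :: "real^('n \<times> 3 + 'n)"
  assume 0: "(mat lam + herm_part H) *v x = 0"
  then have "lam *\<^sub>R vpart x + H *v vpart x = 0" "lam *\<^sub>R rpart x = 0"
    using arg_cong[OF 0[unfolded shifted_skew_part], of vpart]
      arg_cong[OF 0[unfolded shifted_skew_part], of rpart] by simp_all
  then have "lam * (vpart x \<bullet> vpart x) + vpart x \<bullet> (H *v vpart x) = 0" and "rpart x = 0"
    using lam inner_add_right[of "vpart x" "lam *\<^sub>R vpart x" "H *v vpart x"] by auto
  moreover have "0 \<le> lam * (vpart x \<bullet> vpart x)" using lam by simp
  ultimately have "vpart x = 0" using H_pos[of "vpart x"] by fastforce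
  with \<open>rpart x = 0\<close> show "x = 0" by (simp add: parts_eq_0_iff)
qed

lemma invertible_M: "invertible M"
  unfolding hss_precond_def by (rule invertible_mult[OF invertible_herm invertible_skew])

text \<open>Pairing \<open>A x = 0\<close> with \<open>x\<close> leaves only the form of
  \<open>H\<close>, so the velocities vanish; what remains of the equation says that each
  \<open>m i\<close> times its multiplier is zero.\<close>

lemma invertible_A: "invertible A"
  unfolding invertible_iff_ker
proof (intro allI impI)
  fix x :: "real^('n \<times> 3 + 'n)"
  assume "A *v x = 0"
  then have e: "herm_part H *v x + skew_part m *v x = 0"
    by (simp add: saddle_mat_eq matrix_vector_mult_add_rdistrib)
  then have "x \<bullet> (herm_part H *v x) = 0"
    using inner_add_right[of x "herm_part H *v x" "skew_part m *v x"] by (simp add: inner_skew_part)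
  then have "vpart x \<bullet> (H *v vpart x) = 0"
    by (simp add: inner_parts)
  then have v0: "vpart x = 0" using H_pos[of "vpart x"] by fastforce
  then have "herm_part H *v x = 0" by (simp add: parts_eq_0_iff)
  then have "skew_part m *v x = 0" using e by simp
  then have "rpart x $ i *\<^sub>R m i = 0" for i
    using skew_part_mult_vec(1)[of m x i] v0 by simp
  then have "rpart x $ i = 0" for i using m_nz[of i] by (metis scaleR_eq_0_iff)
  then have "rpart x = 0" by (simp add: vec_eq_iff)
  with v0 show "x = 0" by (simp add: parts_eq_0_iff)
qed

section \<open>One step seen on velocities and multipliers\<close>

lemma T_mult_vec: "T *v x = matrix_inv (mat lam + skew_part m) *v ((mat lam - herm_part H) *v
    (matrix_inv (mat lam + herm_part H) *v ((mat lam - skew_part m) *v x)))"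
  by (simp add: hss_mat_def matrix_vector_mul_assoc matrix_mul_assoc)

lemma shifted_skew_T: "(mat lam + skew_part m) *v (T *v x) = (mat lam - herm_part H) *v
    (matrix_inv (mat lam + herm_part H) *v ((mat lam - skew_part m) *v x))"
  by (simp add: T_mult_vec matrix_inv_cancel[OF invertible_skew])

text \<open>In the variable \<open>(lam + S) x\<close> a step is the Cayley transform of
  \<open>S\<close> followed by that of \<open>H\<close>. On multipliers both \<open>lam + H\<close>
  and \<open>lam - H\<close> act as \<open>lam\<close>, so that part passes unchanged.\<close>

lemma T_parts:
  defines "w \<equiv> \<lambda>x. (mat lam - skew_part m) *v x" and "z \<equiv> \<lambda>x. (mat lam + skew_part m) *v x"
  shows "norm (vpart (z (T *v x))) \<le> q * norm (vpart (w x))"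
    and "rpart (z (T *v x)) = rpart (w x)"
proof -
  define u where "u = matrix_inv (mat lam + herm_part H) *v w x"
  have u: "(mat lam + herm_part H) *v u = w x"
    unfolding u_def by (rule matrix_inv_cancel(2)[OF invertible_herm])
  have z: "z (T *v x) = (mat lam - herm_part H) *v u"
    by (simp add: z_def u_def w_def shifted_skew_T)
  show "norm (vpart (z (T *v x))) \<le> q * norm (vpart (w x))"
    unfolding z u[symmetric] using q_bound[of "vpart u"] by (simp add: shifted_skew_part)
  show "rpart (z (T *v x)) = rpart (w x)"
    unfolding z u[symmetric] by (simp add: shifted_skew_part)
qed

lemma denominator_pos: "0 < \<gamma>\<^sup>2 + 1 + q\<^sup>2"
  by (simp add: add_nonneg_pos add_pos_nonneg)

text \<open>The subtracted fraction is at most 1, so the radicand is nonnegative and squaring undoes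
  the root.\<close>

lemma theta2_sq: "\<theta>\<^sup>2 = 1 - (1 - q\<^sup>2) * \<gamma>\<^sup>2 / (\<gamma>\<^sup>2 + 1 + q\<^sup>2)"
proof -
  have "(1 - q\<^sup>2) * \<gamma>\<^sup>2 \<le> 1 * \<gamma>\<^sup>2" by (intro mult_right_mono) auto
  also have "\<dots> \<le> \<gamma>\<^sup>2 + 1 + q\<^sup>2" by simp
  finally have "(1 - q\<^sup>2) * \<gamma>\<^sup>2 / (\<gamma>\<^sup>2 + 1 + q\<^sup>2) \<le> 1"
    using denominator_pos by (simp add: divide_le_eq)
  then show ?thesis unfolding theta2_def by simp
qed

lemma q_sq_less_1: "q\<^sup>2 < 1"
  using q_props by (simp add: abs_square_less_1)

lemma theta2_less_1: "\<theta> < 1"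
proof -
  have "0 < (1 - q\<^sup>2) * \<gamma>\<^sup>2 / (\<gamma>\<^sup>2 + 1 + q\<^sup>2)"
    using denominator_pos q_sq_less_1 \<gamma>_pos by (intro divide_pos_pos mult_pos_pos) auto
  then show ?thesis unfolding theta2_def by simp
qed

lemma theta2_nonneg: "0 \<le> \<theta>"
proof -
  have "0 \<le> 1 - (1 - q\<^sup>2) * \<gamma>\<^sup>2 / (\<gamma>\<^sup>2 + 1 + q\<^sup>2)"
    using theta2_sq zero_le_power2[of \<theta>] by linarith
  then show ?thesis unfolding theta2_def by (rule real_sqrt_ge_zero)
qed

text \<open>Damping acts on the velocity part only. A vector whose multiplier part survives the first
  step undamped has part of it moved into the velocity part by the second Cayley transform.\<close>

lemma two_steps: "skew_norm lam m (T *v (T *v x)) \<le> \<theta> * skew_norm lam m x"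
proof -
  define w z where "w x = (mat lam - skew_part m) *v x" and "z x = (mat lam + skew_part m) *v x"
    for x :: "real^('n \<times> 3 + 'n)"
  define y where "y = T *v x"
  have wz: "norm (w x) = norm (z x)" for x
    unfolding w_def z_def by (rule norm_cayley)
  have damp: "norm (vpart (z (T *v x))) \<le> q * norm (vpart (w x))"
    and keep: "rpart (z (T *v x)) = rpart (w x)" for x
    unfolding w_def z_def by (rule T_parts)+
  \<comment> \<open>The transform of \<open>S\<close> preserves the norm; damping then removes at
    least the fraction \<open>1 - q\<^sup>2\<close> of the squared velocity norm.\<close>
  have step: "(norm (z (T *v x)))\<^sup>2 \<le> (norm (z x))\<^sup>2 - (1 - q\<^sup>2) * (norm (vpart (w x)))\<^sup>2" for x
  proof -
    have "(norm (z (T *v x)))\<^sup>2 \<le> (q * norm (vpart (w x)))\<^sup>2 + (norm (rpart (w x)))\<^sup>2"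
      unfolding norm_parts[of "z (T *v x)"] keep using damp[of x] by (simp add: power_mono)
    also have "\<dots> = (norm (w x))\<^sup>2 - (1 - q\<^sup>2) * (norm (vpart (w x)))\<^sup>2"
      unfolding norm_parts[of "w x"] by (simp add: power_mult_distrib algebra_simps)
    finally show ?thesis by (simp add: wz)
  qed
  \<comment> \<open>The coupling bound is applied at \<open>y\<close>: by \<open>keep\<close>, the
    multiplier part entering the second step is the one that left the first transform.\<close>
  have "\<gamma> * norm (rpart (w x)) \<le> norm (vpart (w y)) + norm (vpart (z y))"
    using cayley_coupling[of lam m y, OF lam m_nz] keep[of x] by (simp add: w_def z_def y_def)
  also have "\<dots> \<le> norm (vpart (w y)) + q * norm (vpart (w x))"
    using damp[of x] by (simp add: y_def)
  finally have "\<gamma>\<^sup>2 / (\<gamma>\<^sup>2 + 1 + q\<^sup>2) * ((norm (vpart (w x)))\<^sup>2 + (norm (rpart (w x)))\<^sup>2)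
      \<le> (norm (vpart (w x)))\<^sup>2 + (norm (vpart (w y)))\<^sup>2"
    using q_props \<gamma>_pos by (intro two_step_arith) auto
  then have "\<gamma>\<^sup>2 / (\<gamma>\<^sup>2 + 1 + q\<^sup>2) * (norm (z x))\<^sup>2
      \<le> (norm (vpart (w x)))\<^sup>2 + (norm (vpart (w y)))\<^sup>2"
    by (simp only: wz flip: norm_parts)
  then have "(1 - q\<^sup>2) * (\<gamma>\<^sup>2 / (\<gamma>\<^sup>2 + 1 + q\<^sup>2) * (norm (z x))\<^sup>2)
      \<le> (1 - q\<^sup>2) * ((norm (vpart (w x)))\<^sup>2 + (norm (vpart (w y)))\<^sup>2)"
    using q_sq_less_1 by (intro mult_left_mono) auto
  \<comment> \<open>Adding \<open>step\<close> at \<open>x\<close> and at \<open>y\<close> cancels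
    the intermediate norm of \<open>z y\<close>.\<close>
  then have "(norm (z (T *v y)))\<^sup>2
      \<le> (norm (z x))\<^sup>2 - (1 - q\<^sup>2) * (\<gamma>\<^sup>2 / (\<gamma>\<^sup>2 + 1 + q\<^sup>2) * (norm (z x))\<^sup>2)"
    using step[of x] step[of y] unfolding y_def[symmetric] by (simp add: distrib_left)
  also have "\<dots> = (\<theta> * norm (z x))\<^sup>2"
    by (simp add: theta2_sq power_mult_distrib left_diff_distrib)
  finally have "norm (z (T *v y)) \<le> \<theta> * norm (z x)"
    by (rule power2_le_imp_le) (simp add: theta2_nonneg)
  then show ?thesis by (simp add: skew_norm_def z_def y_def)
qed

lemma skew_norm_T_power:
  "skew_norm lam m (mat_power T (2 * j) *v x) \<le> \<theta> ^ j * skew_norm lam m x"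
proof (induction j)
  case (Suc j)
  have "mat_power T (2 * Suc j) *v x = T *v (T *v (mat_power T (2 * j) *v x))"
    by (simp add: matrix_vector_mul_assoc matrix_mul_assoc)
  then have "skew_norm lam m (mat_power T (2 * Suc j) *v x)
      \<le> \<theta> * skew_norm lam m (mat_power T (2 * j) *v x)"
    using two_steps by simp
  also have "\<dots> \<le> \<theta> * (\<theta> ^ j * skew_norm lam m x)"
    using Suc theta2_nonneg by (rule mult_left_mono)
  finally show ?case by simp
qed simp

section \<open>Convergence of the stationary iteration\<close>

lemma skew_norm_lower: "lam * norm x \<le> skew_norm lam m x"
  unfolding skew_norm_def
  by (rule power2_le_imp_le) (simp_all add: norm_shifted_skew_part(1) power_mult_distrib)

text \<open>The contraction controls even powers; odd powers follow by one further application of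
  the continuous map \<open>T\<close>.\<close>

lemma T_power_tendsto_0: "(\<lambda>k. mat_power T k *v x) \<longlonglongrightarrow> 0"
proof -
  define e where "e k = mat_power T k *v x" for k
  have "(\<lambda>j. \<theta> ^ j * (skew_norm lam m x / lam)) \<longlonglongrightarrow> 0 * (skew_norm lam m x / lam)"
    using theta2_nonneg theta2_less_1 by (intro tendsto_mult tendsto_const LIMSEQ_realpow_zero)
  then have lim: "(\<lambda>j. \<theta> ^ j * (skew_norm lam m x / lam)) \<longlonglongrightarrow> 0" by simp
  have "norm (e (2 * j)) \<le> \<theta> ^ j * (skew_norm lam m x / lam)" for j
    using order_trans[OF skew_norm_lower skew_norm_T_power, of j x] lam
    by (simp add: e_def field_simps)
  then have even: "(\<lambda>j. e (2 * j)) \<longlonglongrightarrow> 0"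
    by (intro Lim_null_comparison[OF always_eventually[OF allI] lim])
  have "(\<lambda>j. T *v e (2 * j)) \<longlonglongrightarrow> T *v 0"
    by (rule bounded_linear.tendsto[OF matrix_vector_mul_bounded_linear even])
  then have odd: "(\<lambda>j. e (2 * j + 1)) \<longlonglongrightarrow> 0"
    by (simp add: e_def matrix_vector_mul_assoc)
  show ?thesis
    using limseq_even_odd[OF even odd] by (simp add: e_def)
qed

text \<open>The exact solution is fixed by both half-steps, so subtraction removes \<open>b\<close>;
  eliminating the half-step error leaves \<open>T\<close>.\<close>

lemma hss_error:
  assumes it: "hss_iteration lam H m b x xh" and sol: "A *v x_sol = b"
  shows "x k - x_sol = mat_power T k *v (x 0 - x_sol)"
proof (induction k)
  case (Suc k)
  have b: "b = herm_part H *v x_sol + skew_part m *v x_sol"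
    using sol by (simp add: saddle_mat_eq matrix_vector_mult_add_rdistrib)
  have it1: "(mat lam + herm_part H) *v xh k = (mat lam - skew_part m) *v x k + b"
    and it2: "(mat lam + skew_part m) *v x (Suc k) = (mat lam - herm_part H) *v xh k + b"
    using it by (simp_all add: hss_iteration_def add.commute[of "mat lam"])
  have "(mat lam + herm_part H) *v (xh k - x_sol) = (mat lam - skew_part m) *v (x k - x_sol)"
    unfolding matrix_vector_mult_diff_distrib it1 b by (simp add: shifted_skew_part algebra_simps)
  then have "xh k - x_sol = matrix_inv (mat lam + herm_part H) *v ((mat lam - skew_part m) *v (x k - x_sol))"
    by (metis matrix_inv_cancel(1)[OF invertible_herm])
  moreover have "(mat lam + skew_part m) *v (x (Suc k) - x_sol) = (mat lam - herm_part H) *v (xh k - x_sol)"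
    unfolding matrix_vector_mult_diff_distrib it2 b by (simp add: shifted_skew_part algebra_simps)
  ultimately have "(mat lam + skew_part m) *v (x (Suc k) - x_sol) = (mat lam + skew_part m) *v (T *v (x k - x_sol))"
    by (simp only: shifted_skew_T)
  then have "x (Suc k) - x_sol = T *v (x k - x_sol)"
    by (metis matrix_inv_cancel(1)[OF invertible_skew])
  then show ?case
    by (simp add: Suc.IH matrix_vector_mul_assoc)
qed simp

lemma hss_converges:
  assumes "hss_iteration lam H m b x xh" "A *v x_sol = b"
  shows "x \<longlonglongrightarrow> x_sol"
proof -
  have "(\<lambda>k. x k - x_sol) \<longlonglongrightarrow> 0"
    using T_power_tendsto_0[of "x 0 - x_sol"] by (simp only: hss_error[OF assms, symmetric])
  then show ?thesis by (rule LIM_zero_cancel)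
qed

section \<open>GMRES\<close>

text \<open>\<open>M - 2 \<lambda> A = (\<lambda> - H) (\<lambda> - S)\<close>, and the Cayley factors of \<open>H\<close> commute, so the iteration
  matrix is a polynomial in the preconditioned matrix.\<close>

lemma T_eq: "T *v x = x - (2 * lam) *\<^sub>R ((matrix_inv M ** A) *v x)"
proof -
  define u where "u = matrix_inv (mat lam + herm_part H) *v ((mat lam - skew_part m) *v x)"
  have u: "(mat lam + herm_part H) *v u = (mat lam - skew_part m) *v x"
    unfolding u_def by (rule matrix_inv_cancel(2)[OF invertible_herm])
  have "M *v (T *v x) = (mat lam + herm_part H) *v ((mat lam - herm_part H) *v u)"
    unfolding hss_precond_def matrix_vector_mul_assoc[symmetric] shifted_skew_T u_def ..
  \<comment> \<open>Commuting the two shifts of \<open>H\<close> exposes \<open>(lam + H) u\<close>,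
    which clears the inverse inside \<open>u\<close>.\<close>
  also have "\<dots> = (mat lam - herm_part H) *v ((mat lam + herm_part H) *v u)"
    unfolding shifted_skew_part by (simp add: algebra_simps)
  also have "\<dots> = (mat lam - herm_part H) *v ((mat lam - skew_part m) *v x)"
    by (simp only: u)
  also have "\<dots> = (mat lam + herm_part H) *v ((mat lam + skew_part m) *v x)
      - (2 * lam) *\<^sub>R (herm_part H *v x + skew_part m *v x)"
    unfolding shifted_skew_part mult_2 scaleR_add_left
    by (simp add: matrix_vector_right_distrib matrix_vector_mult_diff_distrib
        matrix_vector_mult_scaleR scaleR_add_right scaleR_diff_right)
  also have "\<dots> = M *v x - (2 * lam) *\<^sub>R (A *v x)"
    by (simp add: hss_precond_def saddle_mat_eq matrix_vector_mult_add_rdistrib flip: matrix_vector_mul_assoc)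
  finally have "matrix_inv M *v (M *v (T *v x)) = matrix_inv M *v (M *v x - (2 * lam) *\<^sub>R (A *v x))"
    by simp
  then show ?thesis
    unfolding matrix_vector_mult_diff_distrib matrix_vector_mult_scaleR
      matrix_inv_cancel(1)[OF invertible_M] matrix_vector_mul_assoc[of "matrix_inv M" A] .
qed

text \<open>By \<open>T_eq\<close>, \<open>T ^ k\<close> is a polynomial of degree at most
  \<open>k\<close> in the preconditioned matrix with constant term 1, which is the shape of a GMRES
  residual polynomial.\<close>

lemma T_power_krylov:
  "\<exists>c \<in> krylov (matrix_inv M ** A) r k. mat_power T k *v r = r - (matrix_inv M ** A) *v c"
proof (induction k)
  case 0
  then show ?case by (auto simp: krylov_def)
next
  case (Suc k)
  let ?P = "matrix_inv M ** A"
  let ?K = "krylov ?P r (Suc k)"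
  from Suc obtain c where c: "c \<in> krylov ?P r k" and e: "mat_power T k *v r = r - ?P *v c" by blast
  have "krylov ?P r k \<subseteq> ?K"
    unfolding krylov_def by (intro span_mono image_mono) auto
  with c have cK: "c \<in> ?K" by blast
  have "mat_power ?P 0 *v r \<in> ?K"
    unfolding krylov_def by (intro span_base imageI) simp
  then have rK: "r \<in> ?K" by simp
  \<comment> \<open>Applying the preconditioned matrix raises each power by one, so the image of the
    \<open>k\<close>-th Krylov space lies in the next one.\<close>
  have "(*v) ?P ` krylov ?P r k = span ((*v) ?P ` (\<lambda>i. mat_power ?P i *v r) ` {..<k})"
    unfolding krylov_def by (rule linear_span_image[symmetric]) simp
  also have "\<dots> = span ((\<lambda>i. mat_power ?P (Suc i) *v r) ` {..<k})"
    by (simp add: image_image matrix_vector_mul_assoc)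
  also have "\<dots> \<subseteq> ?K"
    unfolding krylov_def by (rule span_mono) (force simp del: mat_power.simps)
  finally have PcK: "?P *v c \<in> ?K" using c by blast
  have "mat_power T (Suc k) *v r = T *v (r - ?P *v c)"
    by (simp add: e flip: matrix_vector_mul_assoc)
  also have "\<dots> = r - ?P *v (c + (2 * lam) *\<^sub>R (r - ?P *v c))"
    unfolding T_eq by (simp add: matrix_vector_right_distrib matrix_vector_mult_diff_distrib matrix_vector_mult_scaleR)
  finally have "mat_power T (Suc k) *v r = r - ?P *v (c + (2 * lam) *\<^sub>R (r - ?P *v c))" .
  moreover have "c + (2 * lam) *\<^sub>R (r - ?P *v c) \<in> ?K"
    using cK rK PcK unfolding krylov_def by (intro span_add span_scale span_diff)
  ultimately show ?case by blast
qed

lemma prec_residual_add: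
  "prec_residual M A b (x + c) = prec_residual M A b x - (matrix_inv M ** A) *v c"
  by (simp add: prec_residual_def matrix_vector_right_distrib matrix_vector_mult_diff_distrib
      flip: matrix_vector_mul_assoc)

text \<open>The correction from \<open>T_power_krylov\<close> gives an admissible competitor
  \<open>x0 + c\<close> whose residual is exactly the power of \<open>T\<close> applied to the
  initial one.\<close>

lemma gmres_le_T_power:
  assumes "gmres_iterate M A b x0 k x"
  shows "norm (prec_residual M A b x) \<le> norm (mat_power T k *v prec_residual M A b x0)"
proof -
  let ?r = "prec_residual M A b"
  obtain c where c: "c \<in> krylov (matrix_inv M ** A) (?r x0) k"
    and e: "mat_power T k *v ?r x0 = ?r x0 - (matrix_inv M ** A) *v c"
    using T_power_krylov by blast
  have "norm (?r x) \<le> norm (?r (x0 + c))"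
    using assms c unfolding gmres_iterate_def is_arg_min_linorder by blast
  then show ?thesis by (simp add: prec_residual_add e)
qed

text \<open>By \<open>norm_skew_part\<close> the squared norm is a weighted sum over nodes with
  weights \<open>lam\<^sup>2 + (norm (m i))\<^sup>2\<close>, bounded on both sides.\<close>

lemma skew_norm_bounds:
  assumes lo: "0 \<le> m_lo" and b: "\<And>i. m_lo \<le> norm (m i) \<and> norm (m i) \<le> m_hi"
  shows "sqrt (lam\<^sup>2 + m_lo\<^sup>2) * norm x \<le> skew_norm lam m x"
    and "skew_norm lam m x \<le> sqrt (lam\<^sup>2 + m_hi\<^sup>2) * norm x"
proof -
  let ?s = "\<lambda>i. (norm (node (vpart x) i))\<^sup>2 + (rpart x $ i)\<^sup>2"
  have sq: "(skew_norm lam m x)\<^sup>2 = lam\<^sup>2 * (norm x)\<^sup>2 + (norm (skew_part m *v x))\<^sup>2"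
    unfolding skew_norm_def by (rule norm_shifted_skew_part)
  have nn: "0 \<le> skew_norm lam m x" by (simp add: skew_norm_def)
  have "m_lo\<^sup>2 * (norm x)\<^sup>2 \<le> (norm (skew_part m *v x))\<^sup>2"
    unfolding norm_full[of x] norm_skew_part sum_distrib_left
    using lo b by (intro sum_mono mult_right_mono power_mono) auto
  then have "(sqrt (lam\<^sup>2 + m_lo\<^sup>2) * norm x)\<^sup>2 \<le> (skew_norm lam m x)\<^sup>2"
    by (simp add: sq power_mult_distrib distrib_right)
  then show "sqrt (lam\<^sup>2 + m_lo\<^sup>2) * norm x \<le> skew_norm lam m x"
    by (rule power2_le_imp_le[OF _ nn])
  have "(norm (skew_part m *v x))\<^sup>2 \<le> m_hi\<^sup>2 * (norm x)\<^sup>2"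
    unfolding norm_full[of x] norm_skew_part sum_distrib_left
    using b by (intro sum_mono mult_right_mono power_mono) auto
  then have "(skew_norm lam m x)\<^sup>2 \<le> (sqrt (lam\<^sup>2 + m_hi\<^sup>2) * norm x)\<^sup>2"
    by (simp add: sq power_mult_distrib distrib_right)
  then show "skew_norm lam m x \<le> sqrt (lam\<^sup>2 + m_hi\<^sup>2) * norm x"
    by (rule power2_le_imp_le) simp
qed

text \<open>The Euclidean norm is exchanged for the contracting one and back; the ratio of the two
  comparison constants is \<open>kappa\<close>.\<close>

lemma norm_T_power:
  assumes lo: "0 \<le> m_lo" and b: "\<And>i. m_lo \<le> norm (m i) \<and> norm (m i) \<le> m_hi"
  shows "norm (mat_power T (2 * j) *v r) \<le> kappa lam m_lo m_hi * \<theta> ^ j * norm r"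
proof -
  have "sqrt (lam\<^sup>2 + m_lo\<^sup>2) * norm (mat_power T (2 * j) *v r) \<le> \<theta> ^ j * skew_norm lam m r"
    using skew_norm_bounds(1)[OF assms] skew_norm_T_power by (rule order_trans)
  also have "\<dots> \<le> \<theta> ^ j * (sqrt (lam\<^sup>2 + m_hi\<^sup>2) * norm r)"
    using skew_norm_bounds(2)[OF assms] theta2_nonneg by (intro mult_left_mono) auto
  finally show ?thesis
    using lam by (simp add: kappa_def real_sqrt_divide add_pos_nonneg field_simps)
qed

end

lemma gamma_m_unit:
  assumes "\<And>i. norm (m i) = 1"
  shows "gamma_m lam m = 2 * lam / (lam\<^sup>2 + 1)"
  by (simp add: gamma_m_def assms)

theorem theorem1:
  fixes m :: "'n::finite \<Rightarrow> real^3"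
    and H :: "real^('n \<times> 3)^('n \<times> 3)"
    and lam m_lo m_hi :: real
    and b :: "real^('n \<times> 3 + 'n)"
  assumes m_lo_pos: "0 < m_lo"
    and m_bounds: "\<And>i. m_lo \<le> norm (m i) \<and> norm (m i) \<le> m_hi"
    and H_sym: "transpose H = H"
    and H_pos: "\<And>v. v \<noteq> 0 \<Longrightarrow> 0 < v \<bullet> (H *v v)"
    and lam_pos: "0 < lam"
  shows "invertible (mat lam + herm_part H) \<and>
    invertible (mat lam + skew_part m) \<and>
    invertible (hss_precond lam H m) \<and>
    invertible (saddle_mat H m) \<and>
    q_H lam H < 1 \<and>
    theta2 lam H m < 1 \<and>
    (\<forall>x j. skew_norm lam m (mat_power (hss_mat lam H m) (2 * j) *v x)
           \<le> theta2 lam H m ^ j * skew_norm lam m x) \<and>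
    (\<forall>x xh x_sol. hss_iteration lam H m b x xh \<and> saddle_mat H m *v x_sol = b
           \<longrightarrow> x \<longlonglongrightarrow> x_sol) \<and>
    (\<forall>x. (\<forall>j. gmres_iterate (hss_precond lam H m) (saddle_mat H m) b (x 0) j (x j))
             \<and> prec_residual (hss_precond lam H m) (saddle_mat H m) b (x 0) \<noteq> 0
           \<longrightarrow> (\<forall>j. norm (prec_residual (hss_precond lam H m) (saddle_mat H m) b (x (2 * j)))
                   / norm (prec_residual (hss_precond lam H m) (saddle_mat H m) b (x 0))
                 \<le> kappa lam m_lo m_hi * theta2 lam H m ^ j)) \<and>
    ((\<forall>i. norm (m i) = 1)
           \<longrightarrow> kappa lam 1 1 = 1 \<and> gamma_m lam m = 2 * lam / (lam^2 + 1))"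
proof -
  interpret hss m H lam
  proof
    show "m i \<noteq> 0" for i using m_bounds[of i] m_lo_pos by auto
  qed (use H_sym H_pos lam_pos in auto)
  have gmres: "norm (prec_residual M A b (x (2 * j))) / norm (prec_residual M A b (x 0))
      \<le> kappa lam m_lo m_hi * \<theta> ^ j"
    if "\<And>j. gmres_iterate M A b (x 0) j (x j)" "prec_residual M A b (x 0) \<noteq> 0" for x j
    using order_trans[OF gmres_le_T_power[OF that(1)] norm_T_power[OF _ m_bounds]] m_lo_pos that(2)
    by (simp add: divide_le_eq)
  show ?thesis
  proof (intro conjI allI impI)
    have "lam\<^sup>2 + 1 > 0" by (simp add: add_nonneg_pos)
    then show "kappa lam 1 1 = 1" by (simp add: kappa_def)
    show "\<gamma> = 2 * lam / (lam\<^sup>2 + 1)" if "\<forall>i. norm (m i) = 1"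
      using that by (intro gamma_m_unit) simp
    show "x \<longlonglongrightarrow> x_sol" if "hss_iteration lam H m b x xh \<and> A *v x_sol = b" for x xh x_sol
      using that by (intro hss_converges[of b x xh]) auto
    show "norm (prec_residual M A b (x (2 * j))) / norm (prec_residual M A b (x 0))
        \<le> kappa lam m_lo m_hi * \<theta> ^ j"
      if "(\<forall>j. gmres_iterate M A b (x 0) j (x j)) \<and> prec_residual M A b (x 0) \<noteq> 0" for x j
      using that by (intro gmres) auto
    show "\<theta> < 1" by (rule theta2_less_1)
    show "skew_norm lam m (mat_power T (2 * j) *v x) \<le> \<theta> ^ j * skew_norm lam m x" for x j
      by (rule skew_norm_T_power)
  qed (rule invertible_herm invertible_skew invertible_M invertible_A q_props(2))+
qed

end
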